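(* Let $R$ be an $F$-finite Noetherian commutative ring of prime characteristic $p$ and let $\mathcal D$ be a Cartier subalgebra on $R$ such that the pair $(R,\mathcal D)$ is $F$-pure. If $J$ is an ideal of $R$, then $C_{\mathcal D}(J)$ is the largest $\mathcal D$-compatible ideal contained in $J$.
   Context: $F_*^eR=\{F_*^er:r\in R\}$ denotes $R$ viewed as an $R$-module via the $e$-th iterate of Frobenius: $r\,F_*^es=F_*^e(r^{p^e}s)$ (and $F_*^0R=R$). $R$ is $F$-finite if $F_*R$ is a finitely generated $R$-module. The full Cartier algebra is $\mathcal C_R=\bigoplus_{e\ge0}\operatorname{Hom}_R(F_*^eR,R)$ with multiplication, for $\phi$ of degree $e$ and $\psi$ of degree $d$, $(\phi\cdot\psi)(F_*^{e+d}r)=\phi(F_*^e(\psi(F_*^dr)))$. A Cartier subalgebra $\mathcal D=\bigoplus_e\mathcal D_e$ is a graded subalgebra of $\mathcal C_R$ with $\mathcal D_0=\operatorname{Hom}_R(R,R)=R$. The pair $(R,\mathcal D)$ is $F$-pure if there are $e>0$ and $\phi\in\mathcal D_e$ with $\phi(F_*^e1)=1$. The Cartier core of an ideal $J$ is $C_{\mathcal D}(J)=\{r\in R:\phi(F_*^er)\in J\text{ for all }e>0\text{ and all }\phi\in\mathcal D_e\}$. An ideal $J$ is $\mathcal D$-compatible if $\phi(F_*^e(J))\subseteq J$ for all $e$ and all $\phi\in\mathcal D_e$. *)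

theory Defs
  imports "HOL-Algebra.Algebra" "HOL-Computational_Algebra.Primes"
begin

definition ring_char :: "('a, 'm) ring_scheme \<Rightarrow> nat" where
  "ring_char R =
     (if \<exists>n::nat. n > 0 \<and> [n] \<cdot>\<^bsub>R\<^esub> \<one>\<^bsub>R\<^esub> = \<zero>\<^bsub>R\<^esub>
      then LEAST n::nat. n > 0 \<and> [n] \<cdot>\<^bsub>R\<^esub> \<one>\<^bsub>R\<^esub> = \<zero>\<^bsub>R\<^esub>
      else 0)"

definition fin_gen_module :: "('a, 'm) ring_scheme \<Rightarrow> ('a, 'b, 'n) module_scheme \<Rightarrow> bool" where
  "fin_gen_module R M \<longleftrightarrow>
     (\<exists>A. finite A \<and> A \<subseteq> carrier M \<and> \<Inter>{N. submodule N R M \<and> A \<subseteq> N} = carrier M)"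

text \<open>Homomorphisms are taken to be extensional (\<^term>\<open>undefined\<close> outside the carrier), so
  that two of them are equal as HOL functions iff they agree on the module.\<close>

definition module_Hom ::
    "('a, 'm) ring_scheme \<Rightarrow> ('a, 'b, 'n) module_scheme \<Rightarrow> ('a, 'c, 'k) module_scheme \<Rightarrow> ('b \<Rightarrow> 'c) set" where
  "module_Hom R M N =
     {f \<in> carrier M \<rightarrow>\<^sub>E carrier N.
        (\<forall>x\<in>carrier M. \<forall>y\<in>carrier M. f (x \<oplus>\<^bsub>M\<^esub> y) = f x \<oplus>\<^bsub>N\<^esub> f y) \<and>
        (\<forall>r\<in>carrier R. \<forall>x\<in>carrier M. f (r \<odot>\<^bsub>M\<^esub> x) = r \<odot>\<^bsub>N\<^esub> f x)}"

definition regular_module :: "('a, 'm) ring_scheme \<Rightarrow> ('a, 'a) module" where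
  "regular_module R =
     \<lparr>carrier = carrier R, monoid.mult = monoid.mult R, one = \<one>\<^bsub>R\<^esub>, ring.zero = \<zero>\<^bsub>R\<^esub>, add = add R,
      smult = (\<lambda>r s. r \<otimes>\<^bsub>R\<^esub> s)\<rparr>"

text \<open>The \<open>e\<close>-th Frobenius pushforward of \<open>R\<close>. Its element \<open>F\<^sub>*\<^sup>e s\<close> is represented by
  \<open>s\<close> itself, so only the scalar multiplication differs from that of \<open>R\<close>.\<close>

definition frobenius_module :: "('a, 'm) ring_scheme \<Rightarrow> nat \<Rightarrow> nat \<Rightarrow> ('a, 'a) module" where
  "frobenius_module R p e =
     \<lparr>carrier = carrier R, monoid.mult = monoid.mult R, one = \<one>\<^bsub>R\<^esub>, ring.zero = \<zero>\<^bsub>R\<^esub>, add = add R,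
      smult = (\<lambda>r s. (r [^]\<^bsub>R\<^esub> (p ^ e)) \<otimes>\<^bsub>R\<^esub> s)\<rparr>"

definition F_finite :: "('a, 'm) ring_scheme \<Rightarrow> nat \<Rightarrow> bool" where
  "F_finite R p \<longleftrightarrow> fin_gen_module R (frobenius_module R p 1)"

definition cartier_maps :: "('a, 'm) ring_scheme \<Rightarrow> nat \<Rightarrow> nat \<Rightarrow> ('a \<Rightarrow> 'a) set" where
  "cartier_maps R p e = module_Hom R (frobenius_module R p e) (regular_module R)"

text \<open>An element of the direct sum is the finitely supported family of its components; the product
  of homogeneous elements is composition, extended bilinearly by convolution.\<close>

definition cartier_algebra :: "('a, 'm) ring_scheme \<Rightarrow> nat \<Rightarrow> (nat \<Rightarrow> 'a \<Rightarrow> 'a) ring" where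
  "cartier_algebra R p =
     \<lparr>carrier = {\<Phi>. (\<forall>e. \<Phi> e \<in> cartier_maps R p e) \<and>
                    finite {e. \<Phi> e \<noteq> (\<lambda>r\<in>carrier R. \<zero>\<^bsub>R\<^esub>)}},
      monoid.mult = (\<lambda>\<Phi> \<Psi> n. \<lambda>r\<in>carrier R. \<Oplus>\<^bsub>R\<^esub>e\<in>{..n}. \<Phi> e (\<Psi> (n - e) r)),
      one = (\<lambda>n. if n = 0 then (\<lambda>r\<in>carrier R. r) else (\<lambda>r\<in>carrier R. \<zero>\<^bsub>R\<^esub>)),
      ring.zero = (\<lambda>n. \<lambda>r\<in>carrier R. \<zero>\<^bsub>R\<^esub>),
      add = (\<lambda>\<Phi> \<Psi> n. \<lambda>r\<in>carrier R. \<Phi> n r \<oplus>\<^bsub>R\<^esub> \<Psi> n r)\<rparr>"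

definition homogeneous :: "('a, 'm) ring_scheme \<Rightarrow> nat \<Rightarrow> ('a \<Rightarrow> 'a) \<Rightarrow> nat \<Rightarrow> 'a \<Rightarrow> 'a" where
  "homogeneous R e \<phi> = (\<lambda>n. if n = e then \<phi> else (\<lambda>r\<in>carrier R. \<zero>\<^bsub>R\<^esub>))"

definition graded_piece :: "('a, 'm) ring_scheme \<Rightarrow> (nat \<Rightarrow> 'a \<Rightarrow> 'a) set \<Rightarrow> nat \<Rightarrow> ('a \<Rightarrow> 'a) set" where
  "graded_piece R D e = {\<phi>. homogeneous R e \<phi> \<in> D}"

text \<open>In the second condition \<open>D\<close> is required to contain the homogeneous components of its
  elements, i.e. to be the direct sum of its graded pieces. Stability under scalars from \<open>R\<close>
  follows from the last condition together with closure under multiplication.\<close>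

definition cartier_subalgebra :: "('a, 'm) ring_scheme \<Rightarrow> nat \<Rightarrow> (nat \<Rightarrow> 'a \<Rightarrow> 'a) set \<Rightarrow> bool" where
  "cartier_subalgebra R p D \<longleftrightarrow>
     subring D (cartier_algebra R p) \<and>
     (\<forall>\<Phi>\<in>D. \<forall>e. \<Phi> e \<in> graded_piece R D e) \<and>
     graded_piece R D 0 = module_Hom R (regular_module R) (regular_module R)"

definition F_pure_pair :: "('a, 'm) ring_scheme \<Rightarrow> (nat \<Rightarrow> 'a \<Rightarrow> 'a) set \<Rightarrow> bool" where
  "F_pure_pair R D \<longleftrightarrow> (\<exists>e>0. \<exists>\<phi>\<in>graded_piece R D e. \<phi> \<one>\<^bsub>R\<^esub> = \<one>\<^bsub>R\<^esub>)"

definition cartier_core ::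
    "('a, 'm) ring_scheme \<Rightarrow> (nat \<Rightarrow> 'a \<Rightarrow> 'a) set \<Rightarrow> 'a set \<Rightarrow> 'a set" where
  "cartier_core R D J = {r \<in> carrier R. \<forall>e>0. \<forall>\<phi>\<in>graded_piece R D e. \<phi> r \<in> J}"

definition compatible_ideal ::
    "('a, 'm) ring_scheme \<Rightarrow> (nat \<Rightarrow> 'a \<Rightarrow> 'a) set \<Rightarrow> 'a set \<Rightarrow> bool" where
  "compatible_ideal R D J \<longleftrightarrow> ideal J R \<and> (\<forall>e. \<forall>\<phi>\<in>graded_piece R D e. \<phi> ` J \<subseteq> J)"

end

theory Submission
  imports Defs
begin

text \<open>Write \<open>C\<close> for the Cartier core of \<open>J\<close>. The argument rests on the closure of \<open>D\<close> under
  composition. For \<open>\<phi>\<close> of degree \<open>e > 0\<close> and \<open>\<psi>\<close> of degree \<open>d\<close>,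
  the composite \<open>\<phi> \<circ> \<psi>\<close> is in \<open>D\<close> and has positive degree \<open>e + d\<close>; evaluated at an element \<open>r\<close> of
  \<open>C\<close> it lands in \<open>J\<close>, so \<open>\<psi> r\<close> is again in \<open>C\<close>. Degree \<open>0\<close> consists of the multiplications by
  ring elements, so \<open>C\<close> is closed under scalars as well, and it is closed under addition because the
  maps in \<open>D\<close> are additive: \<open>C\<close> is a compatible ideal.

  That \<open>C\<close> lies in \<open>J\<close> is where \<open>F\<close>-purity enters. If \<open>\<phi>\<close> has degree \<open>e > 0\<close> and \<open>\<phi> 1 = 1\<close>, then
  \<open>s \<mapsto> \<phi> (r ^ (p ^ e - 1) * s)\<close> is in \<open>D\<close>, and it sends \<open>r\<close> to
  \<open>\<phi> (r ^ (p ^ e) * 1) = r * \<phi> 1 = r\<close>. Hence \<open>r \<in> C\<close> forces \<open>r \<in> J\<close>.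

  Maximality is immediate: a compatible ideal inside \<open>J\<close> is carried into itself, hence into \<open>J\<close>, by
  every map in \<open>D\<close>.\<close>

context cring
begin

lemma cartier_mapsD:
  assumes "\<phi> \<in> cartier_maps R p e"
  shows "\<And>x. x \<in> carrier R \<Longrightarrow> \<phi> x \<in> carrier R"
    and "\<And>x y. x \<in> carrier R \<Longrightarrow> y \<in> carrier R \<Longrightarrow> \<phi> (x \<oplus> y) = \<phi> x \<oplus> \<phi> y"
    and "\<And>a x. a \<in> carrier R \<Longrightarrow> x \<in> carrier R \<Longrightarrow> \<phi> (a [^] (p ^ e) \<otimes> x) = a \<otimes> \<phi> x"
  using assms
  by (auto simp: cartier_maps_def module_Hom_def frobenius_module_def regular_module_def)

lemma cartier_maps_zero:
  assumes "\<phi> \<in> cartier_maps R p e"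
  shows "\<phi> \<zero> = \<zero>"
proof -
  have "\<phi> \<zero> \<oplus> \<phi> \<zero> = \<phi> \<zero>"
    using cartier_mapsD(2)[OF assms, of \<zero> \<zero>] by simp
  then show ?thesis
    using cartier_mapsD(1)[OF assms, of \<zero>] by (metis add.l_cancel_one' zero_closed)
qed

lemma graded_piece_cartier_maps:
  assumes "cartier_subalgebra R p D" and "\<phi> \<in> graded_piece R D e"
  shows "\<phi> \<in> cartier_maps R p e"
proof -
  have "homogeneous R e \<phi> \<in> carrier (cartier_algebra R p)"
    using assms subringE(1)[of D "cartier_algebra R p"]
    by (auto simp: cartier_subalgebra_def graded_piece_def)
  then have "homogeneous R e \<phi> e \<in> cartier_maps R p e"
    by (simp add: cartier_algebra_def)
  then show ?thesis by (simp add: homogeneous_def)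
qed

text \<open>The convolution of two homogeneous families has only one index where both factors can be
  nonzero; the other terms vanish because additive maps send \<open>\<zero>\<close> to \<open>\<zero>\<close>.\<close>

lemma homogeneous_mult:
  assumes phi: "\<phi> \<in> cartier_maps R p e" and psi: "\<psi> \<in> cartier_maps R p d"
  shows "homogeneous R e \<phi> \<otimes>\<^bsub>cartier_algebra R p\<^esub> homogeneous R d \<psi>
       = homogeneous R (e + d) (\<lambda>r\<in>carrier R. \<phi> (\<psi> r))"
proof (intro ext)
  fix n r
  show "(homogeneous R e \<phi> \<otimes>\<^bsub>cartier_algebra R p\<^esub> homogeneous R d \<psi>) n r
      = homogeneous R (e + d) (\<lambda>r\<in>carrier R. \<phi> (\<psi> r)) n r"
  proof (cases "r \<in> carrier R")
    case r: True
    have psir: "\<psi> r \<in> carrier R" and phipsi: "\<phi> (\<psi> r) \<in> carrier R"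
      using cartier_mapsD(1)[OF psi r] cartier_mapsD(1)[OF phi] by auto
    have summand: "homogeneous R e \<phi> i (homogeneous R d \<psi> (n - i) r)
        = (if i = e then (if n = e + d then \<phi> (\<psi> r) else \<zero>) else \<zero>)" if "i \<le> n" for i
      using that r psir cartier_maps_zero[OF phi] by (auto simp: homogeneous_def)
    have "(homogeneous R e \<phi> \<otimes>\<^bsub>cartier_algebra R p\<^esub> homogeneous R d \<psi>) n r
        = (\<Oplus>i\<in>{..n}. if i = e then (if n = e + d then \<phi> (\<psi> r) else \<zero>) else \<zero>)"
    proof -
      have "(homogeneous R e \<phi> \<otimes>\<^bsub>cartier_algebra R p\<^esub> homogeneous R d \<psi>) n r
          = (\<Oplus>i\<in>{..n}. homogeneous R e \<phi> i (homogeneous R d \<psi> (n - i) r))"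
        using r by (simp add: cartier_algebra_def)
      also have "\<dots> = (\<Oplus>i\<in>{..n}. if i = e then (if n = e + d then \<phi> (\<psi> r) else \<zero>) else \<zero>)"
        by (intro finsum_cong') (use phipsi summand in auto)
      finally show ?thesis .
    qed
    also have "\<dots> = (if n = e + d then \<phi> (\<psi> r) else \<zero>)"
    proof (cases "e \<le> n")
      case True
      then show ?thesis
        using finsum_singleton[of e "{..n}" "\<lambda>_. if n = e + d then \<phi> (\<psi> r) else \<zero>"] phipsi
        by (simp add: eq_commute[of e])
    next
      case False
      then have "(\<Oplus>i\<in>{..n}. if i = e then (if n = e + d then \<phi> (\<psi> r) else \<zero>) else \<zero>)
          = (\<Oplus>i\<in>{..n}. \<zero>)"
        by (intro finsum_cong') auto
      with False show ?thesis by simp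
    qed
    finally show ?thesis using r by (simp add: homogeneous_def)
  next
    case False
    then show ?thesis by (simp add: homogeneous_def cartier_algebra_def)
  qed
qed

lemma graded_piece_comp:
  assumes D: "cartier_subalgebra R p D"
    and phi: "\<phi> \<in> graded_piece R D e" and psi: "\<psi> \<in> graded_piece R D d"
  shows "(\<lambda>r\<in>carrier R. \<phi> (\<psi> r)) \<in> graded_piece R D (e + d)"
proof -
  have "homogeneous R e \<phi> \<otimes>\<^bsub>cartier_algebra R p\<^esub> homogeneous R d \<psi> \<in> D"
    using assms subringE(6)[of D "cartier_algebra R p"]
    by (auto simp: cartier_subalgebra_def graded_piece_def)
  then show ?thesis
    using homogeneous_mult[OF graded_piece_cartier_maps[OF D phi] graded_piece_cartier_maps[OF D psi]]
    by (simp add: graded_piece_def)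
qed

lemma multiplication_in_graded_piece:
  assumes "cartier_subalgebra R p D" and "a \<in> carrier R"
  shows "(\<lambda>r\<in>carrier R. a \<otimes> r) \<in> graded_piece R D 0"
proof -
  have "(\<lambda>r\<in>carrier R. a \<otimes> r) \<in> module_Hom R (regular_module R) (regular_module R)"
    using assms(2) by (auto simp: module_Hom_def regular_module_def r_distr m_lcomm)
  then show ?thesis using assms(1) by (simp add: cartier_subalgebra_def)
qed

lemma cartier_coreD:
  assumes "r \<in> cartier_core R D J" and "\<phi> \<in> graded_piece R D e" and "e > 0"
  shows "\<phi> r \<in> J"
  using assms by (auto simp: cartier_core_def)

lemma cartier_core_stable:
  assumes D: "cartier_subalgebra R p D"
    and r: "r \<in> cartier_core R D J" and psi: "\<psi> \<in> graded_piece R D d"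
  shows "\<psi> r \<in> cartier_core R D J"
proof -
  have rc: "r \<in> carrier R" using r by (simp add: cartier_core_def)
  have "\<phi> (\<psi> r) \<in> J" if "e > 0" and "\<phi> \<in> graded_piece R D e" for e \<phi>
    using cartier_coreD[OF r graded_piece_comp[OF D that(2) psi]] that(1) rc by simp
  then show ?thesis
    using cartier_mapsD(1)[OF graded_piece_cartier_maps[OF D psi] rc]
    by (auto simp: cartier_core_def)
qed

lemma cartier_core_ideal:
  assumes D: "cartier_subalgebra R p D" and J: "ideal J R"
  shows "ideal (cartier_core R D J) R"
proof -
  interpret J: ideal J R by (rule J)
  let ?C = "cartier_core R D J"
  have sub: "?C \<subseteq> carrier R" by (auto simp: cartier_core_def)
  have zero: "\<zero> \<in> ?C"
    unfolding cartier_core_def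
    by (auto dest!: cartier_maps_zero[OF graded_piece_cartier_maps[OF D]])
  have add: "a \<oplus> b \<in> ?C" if "a \<in> ?C" "b \<in> ?C" for a b
    using that unfolding cartier_core_def
    by (auto simp: cartier_mapsD(2)[OF graded_piece_cartier_maps[OF D]])
  have lmult: "a \<otimes> r \<in> ?C" if "a \<in> carrier R" "r \<in> ?C" for a r
    using cartier_core_stable[OF D that(2) multiplication_in_graded_piece[OF D that(1)]] that(2) sub
    by auto
  have rmult: "r \<otimes> a \<in> ?C" if "a \<in> carrier R" "r \<in> ?C" for a r
    using lmult[OF that] m_comm[of r a] that sub by auto
  have inv: "\<ominus> r \<in> ?C" if "r \<in> ?C" for r
    using lmult[of "\<ominus> \<one>" r] that sub l_minus[of \<one> r] by auto
  show ?thesis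
  proof (rule idealI[OF ring_axioms])
    show "subgroup ?C (add_monoid R)"
      by (rule add.subgroupI) (use sub zero add inv in \<open>auto simp: a_inv_def\<close>)
  qed (use lmult rmult in auto)
qed

text \<open>Here \<open>F\<close>-purity is used: precomposing a splitting of degree \<open>e\<close> with multiplication by
  \<open>r ^ (p ^ e - 1)\<close> yields a map in \<open>D\<close> of positive degree that fixes \<open>r\<close>.\<close>

lemma cartier_core_subset:
  assumes D: "cartier_subalgebra R p D" and pure: "F_pure_pair R D" and "p > 0"
  shows "cartier_core R D J \<subseteq> J"
proof
  fix r assume r: "r \<in> cartier_core R D J"
  then have rc: "r \<in> carrier R" by (simp add: cartier_core_def)
  obtain e \<phi> where e: "e > 0" and phi: "\<phi> \<in> graded_piece R D e" and one: "\<phi> \<one> = \<one>"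
    using pure by (auto simp: F_pure_pair_def)
  let ?a = "r [^] (p ^ e - 1)"
  have "(\<lambda>s\<in>carrier R. \<phi> ((\<lambda>s\<in>carrier R. ?a \<otimes> s) s)) \<in> graded_piece R D (e + 0)"
    by (rule graded_piece_comp[OF D phi multiplication_in_graded_piece[OF D]]) (simp add: rc)
  from cartier_coreD[OF r this] e rc have "\<phi> (?a \<otimes> r) \<in> J" by simp
  moreover have "?a \<otimes> r = r [^] (p ^ e) \<otimes> \<one>"
  proof -
    have "Suc (p ^ e - 1) = p ^ e" using \<open>p > 0\<close> by simp
    then show ?thesis using rc nat_pow_Suc[of r "p ^ e - 1"] by simp
  qed
  moreover have "\<phi> (r [^] (p ^ e) \<otimes> \<one>) = r"
    using cartier_mapsD(3)[OF graded_piece_cartier_maps[OF D phi] rc one_closed] one rc by simp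
  ultimately show "r \<in> J" by simp
qed

end

theorem corollary3p20:
  fixes R :: "('a, 'm) ring_scheme" and p :: nat
    and D :: "(nat \<Rightarrow> 'a \<Rightarrow> 'a) set" and J :: "'a set"
  assumes "cring R" and "noetherian_ring R"
    and "Factorial_Ring.prime p" and "ring_char R = p"
    and "F_finite R p"
    and "cartier_subalgebra R p D"
    and "F_pure_pair R D"
    and "ideal J R"
  shows "compatible_ideal R D (cartier_core R D J) \<and>
         cartier_core R D J \<subseteq> J \<and>
         (\<forall>I. compatible_ideal R D I \<and> I \<subseteq> J \<longrightarrow> I \<subseteq> cartier_core R D J)"
proof (intro conjI allI impI)
  interpret cring R by (rule assms(1))
  show "compatible_ideal R D (cartier_core R D J)"
    using cartier_core_ideal[OF assms(6,8)] cartier_core_stable[OF assms(6)]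
    by (auto simp: compatible_ideal_def)
  show "cartier_core R D J \<subseteq> J"
    using cartier_core_subset[OF assms(6,7)] prime_gt_0_nat[OF assms(3)] by blast
  fix I assume "compatible_ideal R D I \<and> I \<subseteq> J"
  then show "I \<subseteq> cartier_core R D J"
    using ideal.Icarr[of I R] unfolding compatible_ideal_def cartier_core_def by blast
qed

end
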